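(* Let $K$ be a radicable (commutative, infinite) idempotent semifield. Then $K$ is order-dense and algebraically closed. Moreover, for all $p \in K[X]$ and $j \in \mathbb{N}$, $$\overline{p}_j = \sum_{k < j \leqslant \ell} \left(p_k^{\,\ell-j}\, p_{\ell}^{\,j-k}\right)^{1/(\ell-k)},$$ where the indices $k, \ell$ run over $\mathbb{N} \cup \{ -1 \}$, with the conventions $0^0=1$ in $K$ and $p_{-1}=0$, and where $\overline p_j$ denotes the infimum of $\{\widehat p(x)x^{-j}:x\in K^*\}$ (which exists).
   Context: A semiring is a commutative monoid $(S,+,0)$ with an associative multiplication having identity $1$, distributing over $+$, and with $0$ absorbing. A semifield is a semiring with $1\neq 0$ in which every nonzero element has a multiplicative inverse; it is idempotent if $x+x=x$ for all $x$. All idempotent semifields are assumed commutative and infinite. An idempotent semifield $K$ is ordered by $x\leqslant y \iff x+y=y$; finite sums are finite suprema. $K^*=K\setminus\{0\}$; $\mathbb{N}$ contains $0$, $\mathbb{N}^*=\mathbb{N}\setminus\{0\}$. $K$ is radicable if for all $y\in K$ and $n\in\mathbb{N}^*$ there is an element $x\in K$ (necessarily unique) with $x^n=y$; it is denoted $y^{1/n}$. $K$ is order-dense if whenever $r<t$ there is $s$ with $r<s<t$. A polynomial $p\in K[X]$ is a formal polynomial $p=\sum_{j\in\mathbb{N}}p_jX^j$ (eventually zero sequence of coefficients), with polynomial function $\widehat p:K\to K$, $\widehat p(x)=\sum_j p_jx^j$. $K$ is algebraically closed if for every $p\in K[X]$ of degree $n>0$ there are $r_1,\dots,r_n\in K$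 with $\widehat p(x)=p_n(x+r_1)\cdots(x+r_n)$ for all $x\in K$. The sum in the formula has only finitely many distinct terms: the terms with $\ell=j$ all equal $p_j$, and the terms with $\ell>\max(j,\deg p)$ are $0$. *)

theory Defs
  imports "HOL-Computational_Algebra.Polynomial" "HOL-Library.Lub_Glb"
begin

text \<open>
  Commutative idempotent semifields. The class \<open>comm_semiring_1\<close> contains the absorption law for
  \<open>0\<close> and \<open>0 \<noteq> 1\<close>. The axiom \<open>le_iff_add_eq\<close> determines the order from the addition (the remaining
  order axioms then follow from idempotence), so the order is no extra structure. The value
  \<open>inverse 0\<close> is unspecified and never used.
\<close>

class idem_semifield = comm_semiring_1 + inverse + order +
  assumes semifield_left_inverse: "x \<noteq> 0 \<Longrightarrow> inverse x * x = 1"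
    and semifield_divide_inverse: "x / y = x * inverse y"
    and add_self_idem: "x + x = x"
    and le_iff_add_eq: "x \<le> y \<longleftrightarrow> x + y = y"

definition radicable :: "'a::idem_semifield itself \<Rightarrow> bool" where
  "radicable _ \<longleftrightarrow> (\<forall>(y::'a) n. 0 < n \<longrightarrow> (\<exists>x. x ^ n = y))"

text \<open>\<open>nth_root n y\<close> is $y^{1/n}$; an \<open>n\<close>-th root in an idempotent semifield is unique if it exists.\<close>

definition nth_root :: "nat \<Rightarrow> 'a::idem_semifield \<Rightarrow> 'a" where
  "nth_root n y = (THE x. x ^ n = y)"

definition order_dense :: "'a::idem_semifield itself \<Rightarrow> bool" where
  "order_dense _ \<longleftrightarrow> (\<forall>r t::'a. r < t \<longrightarrow> (\<exists>s. r < s \<and> s < t))"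

definition algebraically_closed :: "'a::idem_semifield itself \<Rightarrow> bool" where
  "algebraically_closed _ \<longleftrightarrow>
    (\<forall>p::'a poly. 0 < degree p \<longrightarrow>
      (\<exists>r::nat \<Rightarrow> 'a. \<forall>x. poly p x = coeff p (degree p) * (\<Prod>i=1..degree p. x + r i)))"

definition quotient_values :: "'a::idem_semifield poly \<Rightarrow> nat \<Rightarrow> 'a set" where
  "quotient_values p j = {poly p x * inverse x ^ j | x. x \<noteq> 0}"

text \<open>
  $\overline{p}_j$, the infimum of \<open>quotient_values p j\<close>. If that infimum does not exist, the
  value is unspecified.
\<close>

definition pbar :: "'a::idem_semifield poly \<Rightarrow> nat \<Rightarrow> 'a" where
  "pbar p j = (THE m. isGlb UNIV (quotient_values p j) m)"

text \<open>Coefficients with integer index, so that $p_{-1} = 0$.\<close>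

definition coeff_int :: "'a::zero poly \<Rightarrow> int \<Rightarrow> 'a" where
  "coeff_int p k = (if k < 0 then 0 else coeff p (nat k))"

text \<open>
  The set of distinct terms of the sum over $k < j \le \ell$. As addition is idempotent, a sum
  with infinitely many indices but only finitely many distinct terms is the sum of the
  set of its terms.
\<close>

definition pbar_terms :: "'a::idem_semifield poly \<Rightarrow> nat \<Rightarrow> 'a set" where
  "pbar_terms p j =
    {nth_root (nat (l - k)) (coeff_int p k ^ nat (l - int j) * coeff_int p l ^ nat (int j - k))
      | k l. - 1 \<le> k \<and> k < int j \<and> int j \<le> l}"

end

(* A radicable idempotent semifield is an ordered group with 0 adjoined, in which finite sums are
   suprema and taking powers reflects the order.

   For the formula, write q for the sum of the terms. Each term bounds p(x) x^(-j) from below,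
   because (p_k x^k)^(l-j) (p_l x^l)^(j-k) <= p(x)^(l-k). Conversely, let t be nonzero and t >= q.
   With A the sum of the (p_k/t)^(1/(j-k)) for k < j, and B the sum of the (p_l/t)^(1/(l-j)) for
   l > j, the inequality q <= t gives A B <= 1, so x = A + 1/(1+B) is a nonzero element between A
   and 1/B; for it p(x) x^(-j) <= t. So q is the infimum, attained if q is nonzero.

   The same argument shows that the q_j are log-concave, so the ratios r_j = q_(j-1)/q_j increase
   with j, and for such r the product of the x + r_j collapses to the sum of the
   x^j r_(j+1) ... r_n. Since p and the polynomial with coefficients q_j define the same function,
   this factors p. *)
theory Submission imports Defs begin

section \<open>Order and powers in idempotent semifields\<close>

subclass (in idem_semifield) semiring_1_no_zero_divisors
proof
  fix a b :: 'a
  assume ab: "a \<noteq> 0" "b \<noteq> 0"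
  show "a * b \<noteq> 0"
  proof
    assume "a * b = 0"
    then have "inverse a * a * b = 0"
      by (simp add: mult.assoc)
    with ab show False
      by (simp add: semifield_left_inverse)
  qed
qed

subclass (in idem_semifield) semiring_no_zero_divisors_cancel
proof
  fix a b c :: 'a
  have cancel: "a = b" if "c * a = c * b" "c \<noteq> 0"
  proof -
    have "inverse c * c * a = inverse c * c * b"
      using that by (simp add: mult.assoc)
    with that show ?thesis
      by (simp add: semifield_left_inverse)
  qed
  then show "c * a = c * b \<longleftrightarrow> c = 0 \<or> a = b" by auto
  with cancel show "a * c = b * c \<longleftrightarrow> c = 0 \<or> a = b" by (auto simp: mult.commute)
qed

subclass (in idem_semifield) ordered_comm_semiring
proof
  fix a b c :: 'a
  assume ab: "a \<le> b"
  then have "a + b = b"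
    by (simp add: le_iff_add_eq)
  then have "(c + a) + (c + b) = c + b"
    by (metis add.assoc add.left_commute add_self_idem)
  then show "c + a \<le> c + b"
    by (simp add: le_iff_add_eq)
  show "c * a \<le> c * b"
    using \<open>a + b = b\<close> by (metis distrib_left le_iff_add_eq)
qed

subclass (in idem_semifield) canonically_ordered_monoid_add
  by standard (metis add.assoc add_self_idem le_iff_add_eq)

subclass (in idem_semifield) ordered_semiring_1
  by standard (simp add: less_le)

lemma sum_upper:
  fixes f :: "'b \<Rightarrow> 'a::idem_semifield"
  assumes "finite A" "i \<in> A"
  shows "f i \<le> sum f A"
  using assms by (intro member_le_sum) auto

lemma add_least:
  fixes a b c :: "'a::idem_semifield"
  assumes "a \<le> c" "b \<le> c"
  shows "a + b \<le> c"
  using add_mono[OF assms] by (simp add: add_self_idem)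

lemma sum_least:
  fixes f :: "'b \<Rightarrow> 'a::idem_semifield"
  assumes "\<And>i. i \<in> A \<Longrightarrow> f i \<le> b"
  shows "sum f A \<le> b"
  using assms by (induction A rule: infinite_finite_induct) (auto intro: add_least)

lemma mult_left_le_cancel:
  fixes a b c :: "'a::idem_semifield"
  assumes "c \<noteq> 0"
  shows "c * a \<le> c * b \<longleftrightarrow> a \<le> b"
  using assms by (metis le_iff_add_eq distrib_left mult_left_cancel)

text \<open>All monomials of \<open>(x + y) ^ n\<close> other than \<open>x ^ n\<close> already occur in
  \<open>y * (x + y) ^ (n - 1)\<close>, so \<open>x ^ n \<le> y ^ n\<close> makes the two equal, and a
  factor cancels.\<close>

lemma power_le_imp_le:
  fixes x y :: "'a::idem_semifield"
  assumes le: "x ^ n \<le> y ^ n" and n: "0 < n"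
  shows "x \<le> y"
proof (cases "x + y = 0")
  case True
  then show ?thesis by (metis add_self_idem add.commute add.left_commute add_0_right le_iff_add_eq)
next
  case False
  have expand: "(x + y) ^ Suc m = x ^ Suc m + y * (x + y) ^ m" for m
  proof (induction m)
    case (Suc m)
    have "(x + y) ^ Suc (Suc m) = x * (x ^ Suc m + y * (x + y) ^ m) + y * (x + y) ^ Suc m"
      by (subst Suc.IH[symmetric]) (simp add: algebra_simps)
    also have "\<dots> = x ^ Suc (Suc m) + (y * (x * (x + y) ^ m) + y * (x + y) ^ Suc m)"
      by (simp add: algebra_simps)
    also have "y * (x * (x + y) ^ m) \<le> y * (x + y) ^ Suc m"
      unfolding power_Suc by (intro mult_left_mono mult_right_mono) (auto simp: le_iff_add)
    then have "y * (x * (x + y) ^ m) + y * (x + y) ^ Suc m = y * (x + y) ^ Suc m"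
      by (simp add: le_iff_add_eq)
    finally show ?case .
  qed simp
  from n obtain m where m: "n = Suc m" by (cases n) auto
  have "y ^ m \<le> (x + y) ^ m"
    by (rule power_mono) (auto simp: le_iff_add add.commute)
  then have "y ^ n \<le> y * (x + y) ^ m"
    unfolding m by (simp add: mult_left_mono)
  with le have "x ^ n \<le> y * (x + y) ^ m" by (rule order_trans)
  then have "(x + y) ^ Suc m = y * (x + y) ^ m"
    using expand[of m] by (simp add: le_iff_add_eq m)
  then have "x + y = y"
    using mult_right_cancel[OF power_not_zero[OF False]] by (simp only: power_Suc)
  then show ?thesis by (simp add: le_iff_add_eq)
qed

lemma power_inj:
  fixes x y :: "'a::idem_semifield"
  assumes "x ^ n = y ^ n" "0 < n"
  shows "x = y"
  using assms by (metis antisym order_refl power_le_imp_le)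

lemma nth_root_power:
  fixes y :: "'a::idem_semifield"
  assumes "radicable TYPE('a)" "0 < n"
  shows "nth_root n y ^ n = y"
proof -
  from assms obtain x where x: "x ^ n = y" unfolding radicable_def by blast
  then have "(THE x. x ^ n = y) = x"
    using power_inj \<open>0 < n\<close> by (intro the_equality) blast+
  with x show ?thesis by (simp add: nth_root_def)
qed

lemma nth_root_unique:
  fixes x :: "'a::idem_semifield"
  assumes "0 < n"
  shows "nth_root n (x ^ n) = x"
  unfolding nth_root_def using power_inj assms by (intro the_equality) blast+

section \<open>Arbitrarily small nonzero elements and order density\<close>

lemma exists_between_0_1:
  assumes "infinite (UNIV :: 'a::idem_semifield set)"
  obtains u :: "'a::idem_semifield" where "u \<noteq> 0" "u < 1"
proof -
  have "\<exists>y. y \<notin> {0, 1 :: 'a}"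
    using assms by (meson ex_new_if_finite finite.intros)
  then obtain y :: 'a where y: "y \<noteq> 0" "y \<noteq> 1" by auto
  show ?thesis
  proof (cases "y \<le> 1")
    case True
    with y that show ?thesis by auto
  next
    case False
    \<comment> \<open>Since \<open>y\<close> is not below 1, the element \<open>y + 1\<close> lies
      strictly above 1, so its inverse is the wanted element below 1.\<close>
    have nz: "y + 1 \<noteq> 0"
      by (metis le_iff_add le_zero_eq y(1))
    have inv: "inverse (y + 1) * (y + 1) = 1"
      by (rule semifield_left_inverse[OF nz])
    have "inverse (y + 1) * 1 \<le> inverse (y + 1) * (y + 1)"
      by (rule mult_left_mono) (auto simp: le_iff_add add.commute)
    then have "inverse (y + 1) \<le> 1" by (simp add: inv)
    moreover have "inverse (y + 1) \<noteq> 1"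
      using inv False by (auto simp: le_iff_add_eq)
    moreover have "inverse (y + 1) \<noteq> 0" using inv by auto
    ultimately show ?thesis using that by auto
  qed
qed

text \<open>A nonzero \<open>m\<close> fails to lie below the nonzero element \<open>m * u\<close>
  when \<open>u < 1\<close>.\<close>

lemma le_all_nonzero_imp_zero:
  fixes m :: "'a::idem_semifield"
  assumes "infinite (UNIV :: 'a set)" and le: "\<And>t. t \<noteq> 0 \<Longrightarrow> m \<le> t"
  shows "m = 0"
proof (rule ccontr)
  assume m: "m \<noteq> 0"
  obtain u :: 'a where u: "u \<noteq> 0" "u < 1" using exists_between_0_1 assms(1) .
  then have "m * 1 \<le> m * u" using le m by simp
  then show False using m u mult_left_le_cancel[of m 1 u] by simp
qed

text \<open>Estimates below are obtained only for nonzero \<open>t\<close>; this carries them over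
  to \<open>q\<close>, also when \<open>q = 0\<close>. In that case the \<open>n\<close>-th root of
  \<open>m\<close> lies below every nonzero element and therefore vanishes; otherwise
  \<open>t = q\<close> is allowed.\<close>

lemma le_power_if_le_power_above:
  fixes m q :: "'a::idem_semifield"
  assumes "infinite (UNIV :: 'a set)" "radicable TYPE('a)" "0 < n"
    and le: "\<And>t. t \<noteq> 0 \<Longrightarrow> q \<le> t \<Longrightarrow> m \<le> t ^ n"
  shows "m \<le> q ^ n"
proof (cases "q = 0")
  case True
  obtain s where s: "s ^ n = m" using assms unfolding radicable_def by blast
  have "s = 0"
    using le True s \<open>0 < n\<close>
    by (intro le_all_nonzero_imp_zero assms(1)) (auto intro: power_le_imp_le)
  with s \<open>0 < n\<close> show ?thesis by (auto simp: power_0_left)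
qed (use le in auto)

text \<open>Between nonzero \<open>r\<close> and \<open>t\<close> lies their geometric mean, the
  square root of \<open>r * t\<close>; between 0 and \<open>t\<close> lies \<open>t * u\<close> for
  a nonzero \<open>u < 1\<close>.\<close>

lemma order_dense_if_radicable:
  assumes "infinite (UNIV :: 'a::idem_semifield set)" and rad: "radicable TYPE('a)"
  shows "order_dense TYPE('a)"
  unfolding order_dense_def
proof (intro allI impI)
  fix r t :: 'a
  assume rt: "r < t"
  then have t: "t \<noteq> 0" by (metis leD zero_le)
  show "\<exists>s. r < s \<and> s < t"
  proof (cases "r = 0")
    case True
    obtain u :: 'a where u: "u \<noteq> 0" "u < 1" using exists_between_0_1 assms(1) .
    have "t * u \<le> t * 1" "t * u \<noteq> t * 1"
      using u t mult_left_mono[of u 1 t] mult_left_cancel[OF t, of u 1] by auto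
    then show ?thesis using True t u by (intro exI[of _ "t * u"]) (auto simp: less_le)
  next
    case False
    obtain s where s: "s ^ 2 = r * t"
      using rad unfolding radicable_def by (metis zero_less_numeral)
    have "r ^ 2 \<le> s ^ 2" "s ^ 2 \<le> t ^ 2"
      unfolding s using rt by (auto simp: power2_eq_square intro: mult_left_mono mult_right_mono)
    then have "r \<le> s" "s \<le> t" by (auto dest: power_le_imp_le)
    moreover have "s \<noteq> r" "s \<noteq> t" using s False t rt by (auto simp: power2_eq_square)
    ultimately show ?thesis by (auto simp: less_le)
  qed
qed

section \<open>The infimum of the quotient values\<close>

text \<open>With \<open>d = j - k\<close> and \<open>e = l - j\<close>, the identity k e + l d = j
  (e + d) makes the left side equal to the product of the \<open>e\<close>-th power of
  \<open>a * x ^ k\<close> and the \<open>d\<close>-th power of \<open>b * x ^ l\<close>.\<close>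

lemma interpolate_le_power:
  fixes a b P x :: "'a::idem_semifield"
  assumes "a * x ^ k \<le> P" "b * x ^ l \<le> P" "k \<le> j" "j \<le> l"
  shows "a ^ (l - j) * b ^ (j - k) * (x ^ j) ^ (l - k) \<le> P ^ (l - k)"
proof -
  obtain d e where d: "j = k + d" and e: "l = k + d + e"
    using assms(3,4) by (metis le_add_diff_inverse)
  have "a ^ e * b ^ d * (x ^ j) ^ (e + d) = (a * x ^ k) ^ e * (b * x ^ l) ^ d"
    unfolding d e by (simp add: power_mult_distrib flip: power_mult power_add)
      (simp add: algebra_simps power_add)
  also have "\<dots> \<le> P ^ e * P ^ d"
    by (intro mult_mono power_mono assms) auto
  finally show ?thesis by (simp add: d e power_add algebra_simps)
qed

text \<open>For nonzero \<open>x\<close>, the inequality at an index \<open>i < j\<close> amounts to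
  \<open>a i \<le> x\<close>, and the one at \<open>i > j\<close> to \<open>x * b i \<le> 1\<close>.
  The assumption \<open>bound\<close> makes these two kinds of constraints compatible.\<close>

lemma interpolation_bound_attained:
  fixes c :: "nat \<Rightarrow> 'a::idem_semifield"
  assumes rad: "radicable TYPE('a)" and t: "t \<noteq> 0"
    and mid: "c j \<le> t"
    and bound: "\<And>k l. k < j \<Longrightarrow> j < l \<Longrightarrow> c k ^ (l - j) * c l ^ (j - k) \<le> t ^ (l - k)"
  obtains x where "x \<noteq> 0" "\<And>i. i \<le> n \<Longrightarrow> c i * x ^ i \<le> t * x ^ j"
proof -
  define s where "s = inverse t"
  have st: "s * t = 1" unfolding s_def by (rule semifield_left_inverse[OF t])
  define a where "a k = nth_root (j - k) (c k * s)" for k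
  define b where "b l = nth_root (l - j) (c l * s)" for l
  have a: "a k ^ (j - k) = c k * s" if "k < j" for k
    unfolding a_def using that by (intro nth_root_power rad) auto
  have b: "b l ^ (l - j) = c l * s" if "j < l" for l
    unfolding b_def using that by (intro nth_root_power rad) auto
  define A where "A = (\<Sum>k<j. a k)"
  define B where "B = (\<Sum>l\<in>{j<..n}. b l)"
  have ab: "a k * b l \<le> 1" if kl: "k < j" "j < l" for k l
  proof -
    \<comment> \<open>The exponent is a common multiple of the orders of both roots, so all roots
      disappear.\<close>
    have "(a k * b l) ^ ((j - k) * (l - j)) = (a k ^ (j - k)) ^ (l - j) * (b l ^ (l - j)) ^ (j - k)"
      by (simp add: power_mult_distrib mult.commute flip: power_mult)
    also have "\<dots> = c k ^ (l - j) * c l ^ (j - k) * s ^ ((l - j) + (j - k))"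
      unfolding a[OF kl(1)] b[OF kl(2)] by (simp only: power_mult_distrib power_add ac_simps)
    also have "(l - j) + (j - k) = l - k" using kl by simp
    also have "c k ^ (l - j) * c l ^ (j - k) * s ^ (l - k) \<le> t ^ (l - k) * s ^ (l - k)"
      by (intro mult_right_mono bound kl) auto
    also have "\<dots> = 1 ^ ((j - k) * (l - j))"
      using st by (simp add: mult.commute flip: power_mult_distrib)
    finally show ?thesis by (rule power_le_imp_le) (use kl in simp)
  qed
  \<comment> \<open>Adding 1 keeps the denominator nonzero when \<open>B = 0\<close>; adding the
    nonzero \<open>y\<close> to \<open>A\<close> keeps \<open>x\<close> nonzero when
    \<open>A = 0\<close>.\<close>
  define y where "y = inverse (1 + B)"
  have "(1::'a) + B \<noteq> 0" by (metis le_iff_add le_zero_eq one_neq_zero)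
  then have y: "y * (1 + B) = 1" unfolding y_def by (rule semifield_left_inverse)
  define x where "x = A + y"
  have x0: "x \<noteq> 0"
  proof
    assume "x = 0"
    then have "y \<le> 0" unfolding x_def by (metis le_iff_add add.commute)
    then show False using y by simp
  qed
  have "A * B \<le> 1"
    unfolding A_def B_def sum_product by (intro sum_least ab) auto
  moreover have "y * B \<le> y * (1 + B)"
    by (intro mult_left_mono) (auto simp: le_iff_add add.commute)
  ultimately have xB: "x * B \<le> 1"
    unfolding x_def y distrib_right by (rule add_least)
  have "c i * x ^ i \<le> t * x ^ j" if "i \<le> n" for i
  proof -
    have c: "c i * x ^ i = c i * s * (t * x ^ i)"
      using st by (metis mult.assoc mult.right_neutral)
    consider "i < j" | "i = j" | "j < i" by linarith
    then show ?thesis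
    proof cases
      case 1
      have "a i \<le> A" unfolding A_def using 1 by (intro sum_upper) auto
      also have "\<dots> \<le> x" unfolding x_def by (auto simp: le_iff_add)
      finally have "c i * s \<le> x ^ (j - i)" using a[OF 1] by (metis power_mono zero_le)
      then have "c i * s * (t * x ^ i) \<le> x ^ (j - i) * (t * x ^ i)"
        by (rule mult_right_mono) simp
      also have "\<dots> = t * (x ^ (j - i) * x ^ i)" by (simp add: algebra_simps)
      also have "x ^ (j - i) * x ^ i = x ^ j" using 1 by (simp flip: power_add)
      finally show ?thesis by (simp add: c)
    next
      case 2
      then show ?thesis using mid by (simp add: mult_right_mono)
    next
      case 3
      have "b i \<le> B" unfolding B_def using 3 that by (intro sum_upper) auto
      then have "x * b i \<le> 1" using xB by (meson mult_left_mono order_trans zero_le)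
      then have "(x * b i) ^ (i - j) \<le> 1" by (intro power_le_one) auto
      then have le: "x ^ (i - j) * (c i * s) \<le> 1" using b[OF 3] by (simp add: power_mult_distrib)
      have "x ^ i = x ^ (i - j) * x ^ j" using 3 by (simp flip: power_add)
      then have "c i * x ^ i = x ^ (i - j) * (c i * s) * (t * x ^ j)"
        unfolding c by (simp add: algebra_simps)
      also have "\<dots> \<le> 1 * (t * x ^ j)" by (intro mult_right_mono le) auto
      finally show ?thesis by simp
    qed
  qed
  with x0 that show thesis by blast
qed

section \<open>The terms of the sum, reduced to finitely many\<close>

lemma coeff_in_pbar_terms: "coeff p j \<in> pbar_terms (p :: 'a::idem_semifield poly) j"
proof -
  \<comment> \<open>The choice \<open>l = j\<close>, \<open>k = - 1\<close> is available even for
    \<open>j = 0\<close>; the zero coefficient at -1 then has exponent 0 and contributes the factor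
    1.\<close>
  have "nth_root (nat (int j - - 1)) (coeff_int p (- 1) ^ nat (int j - int j) *
      coeff_int p (int j) ^ nat (int j - - 1)) = coeff p j"
    by (simp add: coeff_int_def nth_root_unique)
  then show ?thesis
    unfolding pbar_terms_def by force
qed

lemma nth_root_in_pbar_terms:
  fixes p :: "'a::idem_semifield poly"
  assumes "k < j" "j < l"
  shows "nth_root (l - k) (coeff p k ^ (l - j) * coeff p l ^ (j - k)) \<in> pbar_terms p j"
proof -
  have "nth_root (l - k) (coeff p k ^ (l - j) * coeff p l ^ (j - k)) =
      nth_root (nat (int l - int k)) (coeff_int p (int k) ^ nat (int l - int j) *
        coeff_int p (int l) ^ nat (int j - int k))"
    using assms by (simp add: coeff_int_def nat_diff_distrib)
  moreover have "- 1 \<le> int k" "int k < int j" "int j \<le> int l" using assms by auto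
  ultimately show ?thesis
    unfolding pbar_terms_def by blast
qed

lemma pbar_terms_cases:
  fixes p :: "'a::idem_semifield poly"
  assumes "z \<in> pbar_terms p j"
  obtains "z = 0" | "z = coeff p j"
  | k l where "k < j" "j < l" "l \<le> degree p"
      "z = nth_root (l - k) (coeff p k ^ (l - j) * coeff p l ^ (j - k))"
proof -
  obtain k l where kl: "- 1 \<le> k" "k < int j" "int j \<le> l" and z: "z = nth_root (nat (l - k))
      (coeff_int p k ^ nat (l - int j) * coeff_int p l ^ nat (int j - k))"
    using assms unfolding pbar_terms_def by auto
  have l: "l = int (nat l)" using kl by simp
  have zero: "nth_root (nat (l - k)) (0::'a) = 0"
    using nth_root_unique[of "nat (l - k)" "0::'a"] kl by (simp add: power_0_left)
  \<comment> \<open>For \<open>l > j\<close> both exponents are positive, so a zero coefficient at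
    \<open>k\<close> or at \<open>l\<close> makes the term vanish. A nonzero coefficient at
    \<open>l\<close> bounds \<open>l\<close> by the degree.\<close>
  consider "l = int j" | "int j < l" "k = -1" | "int j < l" "k \<ge> 0" "coeff_int p l = 0"
    | "int j < l" "k \<ge> 0" "coeff_int p l \<noteq> 0"
    using kl by linarith
  then show thesis
  proof cases
    case 1
    then have "z = coeff p j"
      using z kl nth_root_unique[of "nat (int j - k)"] by (simp add: coeff_int_def)
    then show ?thesis by (rule that(2))
  next
    case 2
    then have "z = 0" using z zero by (simp add: coeff_int_def power_0_left)
    then show ?thesis by (rule that(1))
  next
    case 3
    then have "z = 0" using z zero kl by (simp add: power_0_left)
    then show ?thesis by (rule that(1))
  next
    case 4
    then have "nat l \<le> degree p"
      using kl by (auto simp: coeff_int_def intro: le_degree)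
    moreover have "nat (l - k) = nat l - nat k" "nat (l - int j) = nat l - j"
      "nat (int j - k) = j - nat k"
      "nat k < j" "j < nat l" using 4 kl by linarith+
    ultimately show ?thesis
      using 4 kl z by (intro that(3)[of "nat k" "nat l"]) (auto simp: coeff_int_def)
  qed
qed

lemma finite_pbar_terms: "finite (pbar_terms (p :: 'a::idem_semifield poly) j)"
proof (rule finite_subset)
  show "pbar_terms p j \<subseteq> {0, coeff p j} \<union>
      (\<lambda>(k, l). nth_root (l - k) (coeff p k ^ (l - j) * coeff p l ^ (j - k))) `
        ({..<j} \<times> {j<..degree p})"
    by (auto elim!: pbar_terms_cases)
qed auto

lemma coeff_le_sum_pbar_terms: "coeff p j \<le> \<Sum>(pbar_terms (p :: 'a::idem_semifield poly) j)"
  using sum_upper[OF finite_pbar_terms coeff_in_pbar_terms[of p j], of "\<lambda>z. z"] by simp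

lemma interpolation_le_sum_pbar_terms:
  fixes p :: "'a::idem_semifield poly"
  assumes rad: "radicable TYPE('a)" and kl: "k < j" "j < l"
  shows "coeff p k ^ (l - j) * coeff p l ^ (j - k) \<le> \<Sum>(pbar_terms p j) ^ (l - k)"
proof -
  let ?z = "nth_root (l - k) (coeff p k ^ (l - j) * coeff p l ^ (j - k))"
  have "?z \<le> \<Sum>(pbar_terms p j)"
    using sum_upper[OF finite_pbar_terms nth_root_in_pbar_terms[OF kl, of p], of "\<lambda>z. z"] by simp
  then have "?z ^ (l - k) \<le> \<Sum>(pbar_terms p j) ^ (l - k)" by (intro power_mono) auto
  then show ?thesis using nth_root_power[OF rad] kl by simp
qed

section \<open>The sum of the terms as greatest lower bound\<close>

lemma coeff_mult_power_le_poly: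
  fixes p :: "'a::idem_semifield poly"
  shows "coeff p i * x ^ i \<le> poly p x"
proof (cases "i \<le> degree p")
  case True
  then show ?thesis unfolding poly_altdef by (intro sum_upper[where f = "\<lambda>i. coeff p i * x ^ i"]) auto
qed (simp add: coeff_eq_0)

text \<open>Each root term is compared after raising to the power \<open>l - k\<close>, where the
  interpolation inequality applies. The point \<open>x = 0\<close> is included, as the later
  comparison of polynomial functions requires.\<close>

lemma sum_pbar_terms_mult_power_le_poly:
  fixes p :: "'a::idem_semifield poly"
  assumes rad: "radicable TYPE('a)"
  shows "\<Sum>(pbar_terms p j) * x ^ j \<le> poly p x"
  unfolding sum_distrib_right
proof (rule sum_least)
  fix z assume "z \<in> pbar_terms p j"
  then show "z * x ^ j \<le> poly p x"
  proof (cases rule: pbar_terms_cases)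
    case (3 k l)
    have "(z * x ^ j) ^ (l - k) = coeff p k ^ (l - j) * coeff p l ^ (j - k) * (x ^ j) ^ (l - k)"
      using 3 by (simp add: power_mult_distrib nth_root_power[OF rad])
    also have "\<dots> \<le> poly p x ^ (l - k)"
      using 3 by (intro interpolate_le_power coeff_mult_power_le_poly) auto
    finally show ?thesis using 3 by (auto dest: power_le_imp_le)
  qed (auto intro: coeff_mult_power_le_poly)
qed

text \<open>A nonzero \<open>t\<close> above the sum replaces the sum itself, because an infimum
  equal to 0 need not be attained: for the polynomial X and \<open>j = 0\<close> the values are
  exactly the nonzero elements.\<close>

lemma poly_le_if_sum_pbar_terms_le:
  fixes p :: "'a::idem_semifield poly"
  assumes rad: "radicable TYPE('a)" and t: "t \<noteq> 0" "\<Sum>(pbar_terms p j) \<le> t"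
  obtains x where "x \<noteq> 0" "poly p x \<le> t * x ^ j"
proof -
  have "coeff p j \<le> t" using coeff_le_sum_pbar_terms t(2) by (rule order_trans)
  moreover have "coeff p k ^ (l - j) * coeff p l ^ (j - k) \<le> t ^ (l - k)"
    if "k < j" "j < l" for k l
    using interpolation_le_sum_pbar_terms[OF rad that] power_mono[OF t(2)]
    by (rule order_trans) simp
  ultimately obtain x where "x \<noteq> 0" "\<And>i. i \<le> degree p \<Longrightarrow> coeff p i * x ^ i \<le> t * x ^ j"
    using interpolation_bound_attained[OF rad t(1), where c = "coeff p"] by metis
  then show thesis
    by (intro that) (auto simp: poly_altdef intro: sum_least)
qed

lemma isGlb_quotient_values:
  fixes p :: "'a::idem_semifield poly"
  assumes "infinite (UNIV :: 'a set)" and rad: "radicable TYPE('a)"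
  shows "isGlb UNIV (quotient_values p j) (\<Sum>(pbar_terms p j))"
proof -
  let ?q = "\<Sum>(pbar_terms p j)"
  have inv: "x ^ j * inverse x ^ j = 1" if "x \<noteq> 0" for x :: 'a
    using semifield_left_inverse[OF that] by (simp add: mult.commute flip: power_mult_distrib)
  have lower: "?q \<le> y" if mem: "y \<in> quotient_values p j" for y
  proof -
    obtain x where x: "x \<noteq> 0" and y: "y = poly p x * inverse x ^ j"
      using mem unfolding quotient_values_def by auto
    have "?q * x ^ j * inverse x ^ j \<le> y"
      unfolding y by (intro mult_right_mono sum_pbar_terms_mult_power_le_poly rad) auto
    then show ?thesis by (simp only: mult.assoc inv[OF x] mult.right_neutral)
  qed
  have greatest: "m \<le> ?q" if m: "\<forall>y\<in>quotient_values p j. m \<le> y" for m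
  proof -
    \<comment> \<open>A lower bound is compared first with every nonzero \<open>t\<close> above the
      sum; the passage to the sum itself is the case of exponent 1 in
      \<open>le_power_if_le_power_above\<close>.\<close>
    have "m \<le> t" if t: "t \<noteq> 0" "?q \<le> t" for t
    proof -
      obtain x where x: "x \<noteq> 0" "poly p x \<le> t * x ^ j"
        using poly_le_if_sum_pbar_terms_le[OF rad t] .
      have "m \<le> poly p x * inverse x ^ j"
        using m x unfolding quotient_values_def by auto
      also have "\<dots> \<le> t * x ^ j * inverse x ^ j" using x by (intro mult_right_mono) auto
      finally show ?thesis by (simp only: mult.assoc inv[OF x(1)] mult.right_neutral)
    qed
    then show ?thesis
      using le_power_if_le_power_above[OF assms, of 1 ?q m] by simp
  qed
  show ?thesis
    unfolding isGlb_def greatestP_def isLb_def setge_def setle_def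
    using lower greatest by blast
qed

lemma isGlb_unique:
  assumes "isGlb R S x" "isGlb R S (y :: 'a::order)"
  shows "x = y"
  using assms unfolding isGlb_def greatestP_def setle_def by (auto intro: antisym)

lemma pbar_eq:
  fixes p :: "'a::idem_semifield poly"
  assumes "infinite (UNIV :: 'a set)" "radicable TYPE('a)"
  shows "pbar p j = \<Sum>(pbar_terms p j)"
  unfolding pbar_def
  using isGlb_quotient_values[OF assms] isGlb_unique by (intro the_equality) blast+

section \<open>Factorisation\<close>

text \<open>One point \<open>x\<close> with \<open>poly p x \<le> t * x ^ j\<close> bounds
  \<open>pbar p i * x ^ i\<close> by \<open>t * x ^ j\<close> for all \<open>i\<close> at once.
  Interpolating between \<open>k\<close> and \<open>l\<close> and cancelling the power of
  \<open>x\<close> gives the claim with \<open>t\<close> in place of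
  \<open>pbar p j\<close>.\<close>

lemma pbar_log_concave:
  fixes p :: "'a::idem_semifield poly"
  assumes "infinite (UNIV :: 'a set)" and rad: "radicable TYPE('a)" and kl: "k < j" "j < l"
  shows "pbar p k ^ (l - j) * pbar p l ^ (j - k) \<le> pbar p j ^ (l - k)"
proof (rule le_power_if_le_power_above[OF assms(1,2)])
  fix t assume t: "t \<noteq> 0" "pbar p j \<le> t"
  then obtain x where x: "x \<noteq> 0" "poly p x \<le> t * x ^ j"
    using poly_le_if_sum_pbar_terms_le[OF rad] pbar_eq[OF assms(1,2)] by metis
  have le: "pbar p i * x ^ i \<le> t * x ^ j" for i
    using sum_pbar_terms_mult_power_le_poly[OF rad] x(2)
    unfolding pbar_eq[OF assms(1,2)] by (rule order_trans)
  have "pbar p k ^ (l - j) * pbar p l ^ (j - k) * (x ^ j) ^ (l - k) \<le> (t * x ^ j) ^ (l - k)"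
    using kl by (intro interpolate_le_power le) auto
  then have "(x ^ j) ^ (l - k) * (pbar p k ^ (l - j) * pbar p l ^ (j - k))
      \<le> (x ^ j) ^ (l - k) * t ^ (l - k)"
    by (simp add: algebra_simps)
  then show "pbar p k ^ (l - j) * pbar p l ^ (j - k) \<le> t ^ (l - k)"
    using x(1) by (subst (asm) mult_left_le_cancel) auto
qed (use kl in simp)

lemma poly_eq_sum_pbar:
  fixes p :: "'a::idem_semifield poly"
  assumes "infinite (UNIV :: 'a set)" "radicable TYPE('a)"
  shows "poly p x = (\<Sum>j\<le>degree p. pbar p j * x ^ j)"
proof (rule antisym)
  show "poly p x \<le> (\<Sum>j\<le>degree p. pbar p j * x ^ j)"
    unfolding poly_altdef pbar_eq[OF assms]
    by (intro sum_mono mult_right_mono coeff_le_sum_pbar_terms) auto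
  show "(\<Sum>j\<le>degree p. pbar p j * x ^ j) \<le> poly p x"
    unfolding pbar_eq[OF assms] by (intro sum_least sum_pbar_terms_mult_power_le_poly assms)
qed

text \<open>No index \<open>l\<close> lies strictly between the top index and infinity with a
  nonzero coefficient, so only 0 and the leading coefficient remain as terms.\<close>

lemma pbar_degree:
  fixes p :: "'a::idem_semifield poly"
  assumes "infinite (UNIV :: 'a set)" "radicable TYPE('a)"
  shows "pbar p (degree p) = coeff p (degree p)"
  unfolding pbar_eq[OF assms]
proof (rule antisym[OF sum_least coeff_le_sum_pbar_terms])
  fix z assume "z \<in> pbar_terms p (degree p)"
  then show "z \<le> coeff p (degree p)" by (cases rule: pbar_terms_cases) auto
qed

text \<open>The coefficient of \<open>x ^ j\<close> in the expanded product is the elementary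
  symmetric sum of degree \<open>n - j\<close>, which equals its largest summand, the product of the
  last \<open>n - j\<close> values of \<open>r\<close>.\<close>

lemma prod_add_eq_sum_if_increasing:
  fixes r :: "nat \<Rightarrow> 'a::idem_semifield"
  assumes "\<And>i. 1 \<le> i \<Longrightarrow> i < n \<Longrightarrow> r i \<le> r (Suc i)"
  shows "(\<Prod>i=1..n. x + r i) = (\<Sum>j\<le>n. (\<Prod>i\<in>{j<..n}. r i) * x ^ j)"
  using assms
proof (induction n)
  case (Suc n)
  define R where "R m j = (\<Prod>i\<in>{j<..m}. r i)" for m j
  have top: "R (Suc n) j = R n j * r (Suc n)" if "j \<le> n" for j
  proof -
    have "{j<..Suc n} = insert (Suc n) {j<..n}" using that by auto
    then show ?thesis by (simp add: R_def mult.commute)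
  qed
  have bottom: "R n j = r (Suc j) * R n (Suc j)" if "j < n" for j
  proof -
    have "{j<..n} = insert (Suc j) {Suc j<..n}" using that by auto
    then show ?thesis by (simp add: R_def)
  qed
  have le_last: "r (Suc j) \<le> r (Suc n)" if "j \<le> n" for j
    using that
  proof (induction rule: inc_induct)
    case (step i)
    then show ?case using Suc.prems[of "Suc i"] by (auto intro: order_trans)
  qed simp
  have absorbed: "R n j * x ^ Suc j \<le> (\<Sum>j\<le>Suc n. R (Suc n) j * x ^ j)" if "j \<le> n" for j
  proof -
    \<comment> \<open>Both products have the same number of factors; the second has
      \<open>r (Suc n)\<close> in place of the smaller \<open>r (Suc j)\<close>.\<close>
    have "R n j \<le> R (Suc n) (Suc j)"
    proof (cases "j = n")
      case True
      then show ?thesis by (simp add: R_def)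
    next
      case False
      with that have "j < n" by simp
      then show ?thesis
        using le_last[of j] by (simp add: bottom top mult.commute mult_right_mono)
    qed
    then have "R n j * x ^ Suc j \<le> R (Suc n) (Suc j) * x ^ Suc j"
      by (rule mult_right_mono) simp
    also have "\<dots> \<le> (\<Sum>j\<le>Suc n. R (Suc n) j * x ^ j)"
      using that by (intro sum_upper[where f = "\<lambda>j. R (Suc n) j * x ^ j"]) auto
    finally show ?thesis .
  qed
  have "(\<Prod>i=1..Suc n. x + r i) = (\<Sum>j\<le>n. R n j * x ^ j) * (x + r (Suc n))"
    using Suc by (simp add: R_def)
  also have "\<dots> = (\<Sum>j\<le>n. R n j * x ^ Suc j) + (\<Sum>j\<le>n. R (Suc n) j * x ^ j)"
    by (simp add: distrib_left sum_distrib_left sum_distrib_right sum.distrib top ac_simps)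
  also have "\<dots> = (\<Sum>j\<le>Suc n. R (Suc n) j * x ^ j)"
  proof (rule antisym)
    have "(\<Sum>j\<le>n. R (Suc n) j * x ^ j) \<le> (\<Sum>j\<le>Suc n. R (Suc n) j * x ^ j)"
      by (auto simp: le_iff_add)
    moreover have "(\<Sum>j\<le>n. R n j * x ^ Suc j) \<le> (\<Sum>j\<le>Suc n. R (Suc n) j * x ^ j)"
      by (intro sum_least absorbed) simp
    ultimately show "(\<Sum>j\<le>n. R n j * x ^ Suc j) + (\<Sum>j\<le>n. R (Suc n) j * x ^ j)
        \<le> (\<Sum>j\<le>Suc n. R (Suc n) j * x ^ j)"
      by (intro add_least)
    \<comment> \<open>The top power is the one term missing from the second sum; it is the term
      \<open>j = n\<close> of the first, both coefficients being empty products.\<close>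
    have "R (Suc n) (Suc n) * x ^ Suc n = R n n * x ^ Suc n"
      by (simp add: R_def)
    also have "\<dots> \<le> (\<Sum>j\<le>n. R n j * x ^ Suc j)"
      by (intro sum_upper[where f = "\<lambda>j. R n j * x ^ Suc j"]) auto
    finally have "R (Suc n) (Suc n) * x ^ Suc n \<le> (\<Sum>j\<le>n. R n j * x ^ Suc j)" .
    then show "(\<Sum>j\<le>Suc n. R (Suc n) j * x ^ j)
        \<le> (\<Sum>j\<le>n. R n j * x ^ Suc j) + (\<Sum>j\<le>n. R (Suc n) j * x ^ j)"
      by (subst sum.atMost_Suc, subst add.commute) (rule add_right_mono)
  qed
  finally show ?case by (simp add: R_def)
qed simp

lemma algebraically_closed_if_radicable:
  assumes K: "infinite (UNIV :: 'a::idem_semifield set)" "radicable TYPE('a)"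
  shows "algebraically_closed TYPE('a)"
  unfolding algebraically_closed_def
proof (intro allI impI)
  fix p :: "'a poly"
  assume deg: "0 < degree p"
  define n where "n = degree p"
  define q where "q = pbar p"
  have qn: "q n = coeff p n" unfolding q_def n_def by (rule pbar_degree[OF K])
  have qn0: "q n \<noteq> 0"
    using deg qn unfolding n_def by (auto simp: leading_coeff_0_iff)
  \<comment> \<open>Log-concavity at \<open>k < j < n\<close> with \<open>q n\<close> nonzero: the
    zeros of \<open>q\<close> up to \<open>n\<close> form an initial segment.\<close>
  have q_zero: "q k = 0" if "q j = 0" "k < j" "j \<le> n" for k j
  proof -
    have "j < n" using that qn0 by (cases "j = n") auto
    then have "q k ^ (n - j) * q n ^ (j - k) \<le> q j ^ (n - k)"
      unfolding q_def using that by (intro pbar_log_concave K)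
    then show ?thesis using that qn0 by (auto simp: power_0_left split: if_splits)
  qed
  text \<open>If \<open>q i = 0\<close> then also \<open>q (i - 1) = 0\<close>, so the unspecified
    \<open>inverse 0\<close> is multiplied by \<open>0\<close>.\<close>
  define r where "r i = q (i - 1) * inverse (q i)" for i
  have q_pred: "q j = r (Suc j) * q (Suc j)" if "j < n" for j
  proof (cases "q (Suc j) = 0")
    case True
    then show ?thesis using q_zero[OF True] that by simp
  next
    case False
    then show ?thesis
      using semifield_left_inverse[OF False] by (simp add: r_def mult.assoc)
  qed
  have incr: "r i \<le> r (Suc i)" if i: "1 \<le> i" "i < n" for i
  proof (cases "q i = 0")
    case True
    then have "q (i - 1) = 0" using q_zero[OF True] i by simp
    then show ?thesis by (simp add: r_def)
  next
    case False
    have nz: "q (Suc i) \<noteq> 0" using q_zero[of "Suc i" i] False i by auto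
    obtain h where h: "i = Suc h" using i by (cases i) auto
    \<comment> \<open>Log-concavity at three consecutive indices is the monotonicity of the ratios,
      once \<open>q i * q (Suc i)\<close> is cancelled.\<close>
    have "q h ^ (Suc i - i) * q (Suc i) ^ (i - h) \<le> q i ^ (Suc i - h)"
      unfolding q_def h by (intro pbar_log_concave K) auto
    then have "q h * q (Suc i) \<le> q i * q i" by (simp add: h power2_eq_square)
    moreover have "q h = r i * q i" using q_pred[of h] h i by simp
    moreover have "q i = r (Suc i) * q (Suc i)" using q_pred i by simp
    ultimately have "(q i * q (Suc i)) * r i \<le> (q i * q (Suc i)) * r (Suc i)"
      by (metis mult.assoc mult.commute)
    then show ?thesis using False nz by (subst (asm) mult_left_le_cancel) auto
  qed
  \<comment> \<open>The ratios telescope downwards from \<open>n\<close>.\<close>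
  have q_prod: "q j = q n * (\<Prod>i\<in>{j<..n}. r i)" if "j \<le> n" for j
    using that
  proof (induction rule: inc_induct)
    case (step j)
    have "{j<..n} = insert (Suc j) {Suc j<..n}" using step by auto
    then show ?case using step q_pred[of j] by (simp add: mult.left_commute)
  qed simp
  have "poly p x = coeff p n * (\<Prod>i=1..n. x + r i)" for x
  proof -
    have "poly p x = (\<Sum>j\<le>n. q j * x ^ j)"
      unfolding n_def q_def by (rule poly_eq_sum_pbar[OF K])
    also have "\<dots> = (\<Sum>j\<le>n. q n * ((\<Prod>i\<in>{j<..n}. r i) * x ^ j))"
      by (intro sum.cong refl) (metis q_prod mult.assoc atMost_iff)
    also have "\<dots> = q n * (\<Prod>i=1..n. x + r i)"
      using prod_add_eq_sum_if_increasing[of n r x] incr by (simp add: sum_distrib_left)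
    finally show ?thesis by (simp add: qn)
  qed
  then show "\<exists>r. \<forall>x. poly p x = coeff p (degree p) * (\<Prod>i=1..degree p. x + r i)"
    unfolding n_def by blast
qed

theorem theorem7p9:
  assumes "infinite (UNIV :: 'a::idem_semifield set)"
    and "radicable TYPE('a)"
  shows "order_dense TYPE('a) \<and> algebraically_closed TYPE('a) \<and>
    (\<forall>(p::'a poly) j.
      isGlb UNIV (quotient_values p j) (pbar p j) \<and>
      finite (pbar_terms p j) \<and>
      pbar p j = \<Sum>(pbar_terms p j))"
  using order_dense_if_radicable[OF assms] algebraically_closed_if_radicable[OF assms]
    isGlb_quotient_values[OF assms] finite_pbar_terms pbar_eq[OF assms]
  by metis

end
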